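(* For every integer $J\ge 0$, the wavelet transform $\mathcal{W}^{(1)}_J=\{\Psi^{(1)}_j,\Phi^{(1)}_J\}_{0\le j\le J}$ is an isometry from $\mathbf{L}^2(\mathbf{M})$ to $\ell^2(\mathbf{L}^2(\mathbf{M}))$; that is, for all $\mathbf{x}\in\mathbf{L}^2(\mathbf{M})$, $$\big\|\mathcal{W}^{(1)}_J\mathbf{x}\big\|_{\mathbf{M}}^2:=\sum_{j=0}^{J}\big\|\Psi^{(1)}_j\mathbf{x}\big\|_{\mathbf{M}}^2+\big\|\Phi^{(1)}_J\mathbf{x}\big\|_{\mathbf{M}}^2=\|\mathbf{x}\|_{\mathbf{M}}^2 .$$
   Context: Let $G=(V,E,W)$ be a weighted, connected (undirected) graph with vertices $\{0,\dots,n-1\}$, weighted adjacency matrix $\mathbf{A}$, weighted degree vector $\mathbf{d}$, and $\mathbf{D}=\mathrm{diag}(\mathbf{d})$. Let $\mathbf{N}=\mathbf{I}-\mathbf{D}^{-1/2}\mathbf{A}\mathbf{D}^{-1/2}$ have eigenvalues $0=\omega_0<\omega_1\le\dots\le\omega_{n-1}\le 2$ and orthonormal eigenbasis $\mathbf{v}_0,\dots,\mathbf{v}_{n-1}$ of $\mathbb{R}^n$, $\mathbf{N}\mathbf{v}_i=\omega_i\mathbf{v}_i$, and let $\mathbf{V}$ be the orthogonal matrix with columns $\mathbf{v}_i$. Let $g:[0,2]\to[0,1]$ be a monotonically decreasing function with $g(0)=1$, $g(2)=0$; put $\lambda_i=g(\omega_i)$, so $1=\lambda_0>\lambda_1\ge\dots\ge\lambda_{n-1}\ge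 0$, $\Lambda=\mathrm{diag}(\lambda_0,\dots,\lambda_{n-1})$ and $\mathbf{T}=\mathbf{V}\Lambda\mathbf{V}^T$. Let $\mathbf{M}$ be an invertible real $n\times n$ matrix and $\mathbf{K}=\mathbf{M}^{-1}\mathbf{T}\mathbf{M}$. $\mathbf{L}^2(\mathbf{M})$ is $\mathbb{R}^n$ with inner product $\langle\mathbf{x},\mathbf{y}\rangle_{\mathbf{M}}=\langle\mathbf{M}\mathbf{x},\mathbf{M}\mathbf{y}\rangle_2$ and norm $\|\mathbf{x}\|_{\mathbf{M}}=\|\mathbf{M}\mathbf{x}\|_2$. For $J\ge0$ let $p_0(t)=1-t$, $p_j(t)=t^{2^{j-1}}-t^{2^j}$ for $1\le j\le J$, $p_{J+1}(t)=t^{2^J}$, and $q_j(t)=p_j(t)^{1/2}$ for $0\le t\le 1$. Define $q_j(\mathbf{K})=\mathbf{M}^{-1}\mathbf{V}q_j(\Lambda)\mathbf{V}^T\mathbf{M}$, where $q_j(\Lambda)$ is the diagonal matrix with entries $q_j(\lambda_i)$. Set $\Psi^{(1)}_j=q_j(\mathbf{K})$ for $0\le j\le J$ and $\Phi^{(1)}_J=q_{J+1}(\mathbf{K})$. *)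

theory Defs
  imports "HOL-Analysis.Analysis"
begin

text \<open>
  Vertices, eigenvalues and eigenvectors are all indexed by the same finite linearly ordered type
  \<open>'n\<close>, which plays the role of \<open>{0, \<dots>, n - 1}\<close>; the order is used to list the eigenvalues
  increasingly.
\<close>

definition diag_matrix :: "('n \<Rightarrow> real) \<Rightarrow> real ^ 'n ^ 'n" where
  "diag_matrix a = (\<chi> i j. if i = j then a i else 0)"

text \<open>
  An undirected edge is the set of its end points; a singleton edge is a loop, which is not
  excluded. The values of \<open>W\<close> outside \<open>E\<close> are irrelevant.
\<close>

definition weighted_graph :: "'n set set \<Rightarrow> ('n set \<Rightarrow> real) \<Rightarrow> bool" where
  "weighted_graph E W \<longleftrightarrow> (\<forall>e\<in>E. (\<exists>u v. e = {u, v}) \<and> W e > 0)"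

definition connected_graph :: "'n set set \<Rightarrow> bool" where
  "connected_graph E \<longleftrightarrow> (\<forall>u v. (u, v) \<in> {(a, b). {a, b} \<in> E}\<^sup>*)"

definition adj_matrix :: "'n set set \<Rightarrow> ('n set \<Rightarrow> real) \<Rightarrow> real ^ 'n ^ 'n" where
  "adj_matrix E W = (\<chi> i j. if {i, j} \<in> E then W {i, j} else 0)"

definition degree_vec :: "'n::finite set set \<Rightarrow> ('n set \<Rightarrow> real) \<Rightarrow> real ^ 'n" where
  "degree_vec E W = (\<chi> i. \<Sum>j\<in>UNIV. adj_matrix E W $ i $ j)"

text \<open>
  In a connected graph all degrees are positive, except for a single vertex without a loop; there
  \<open>1 / sqrt 0 = 0\<close> makes the normalized Laplacian the identity.
\<close>

definition normalized_laplacian :: "'n::finite set set \<Rightarrow> ('n set \<Rightarrow> real) \<Rightarrow> real ^ 'n ^ 'n" where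
  "normalized_laplacian E W =
     (let R = diag_matrix (\<lambda>i. 1 / sqrt (degree_vec E W $ i)) in mat 1 - R ** adj_matrix E W ** R)"

definition orthonormal_eigenbasis ::
    "((real, 'n) vec, 'n) vec \<Rightarrow> ('n::{finite,linorder} \<Rightarrow> real) \<Rightarrow> ('n \<Rightarrow> (real, 'n) vec) \<Rightarrow> bool" where
  "orthonormal_eigenbasis N \<omega> v \<longleftrightarrow>
     mono \<omega> \<and> (\<forall>i j. v i \<bullet> v j = (if i = j then 1 else 0)) \<and> (\<forall>i. N *v v i = \<omega> i *\<^sub>R v i)"

definition columns_matrix :: "('n \<Rightarrow> real ^ 'n) \<Rightarrow> real ^ 'n ^ 'n" where
  "columns_matrix v = (\<chi> r c. v c $ r)"

definition norm_wrt :: "real ^ 'n ^ 'n \<Rightarrow> real ^ 'n \<Rightarrow> real" where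
  "norm_wrt M x = norm (M *v x)"

text \<open>
  The functional calculus \<open>f(K) = M\<^sup>-\<^sup>1 V f(\<Lambda>) V\<^sup>T M\<close>; the matrix
  \<open>K = M\<^sup>-\<^sup>1 T M\<close>, \<open>T = V \<Lambda> V\<^sup>T\<close>, itself is the case where \<open>f\<close> is the identity.
\<close>

definition fun_of_K ::
    "real ^ 'n ^ 'n \<Rightarrow> ('n \<Rightarrow> real ^ 'n) \<Rightarrow> ('n \<Rightarrow> real) \<Rightarrow> (real \<Rightarrow> real) \<Rightarrow> real ^ 'n ^ 'n" where
  "fun_of_K M v lam f =
     (let V = columns_matrix v
      in matrix_inv M ** V ** diag_matrix (\<lambda>i. f (lam i)) ** transpose V ** M)"

definition p_fun :: "nat \<Rightarrow> nat \<Rightarrow> real \<Rightarrow> real" where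
  "p_fun J j t =
     (if j = 0 then 1 - t
      else if j \<le> J then t ^ (2 ^ (j - 1)) - t ^ (2 ^ j)
      else t ^ (2 ^ J))"

definition q_fun :: "nat \<Rightarrow> nat \<Rightarrow> real \<Rightarrow> real" where
  "q_fun J j t = sqrt (p_fun J j t)"

definition Psi1 ::
    "real ^ 'n ^ 'n \<Rightarrow> ('n \<Rightarrow> real ^ 'n) \<Rightarrow> ('n \<Rightarrow> real) \<Rightarrow> nat \<Rightarrow> nat \<Rightarrow> real ^ 'n ^ 'n" where
  "Psi1 M v lam J j = fun_of_K M v lam (q_fun J j)"

definition Phi1 ::
    "real ^ 'n ^ 'n \<Rightarrow> ('n \<Rightarrow> real ^ 'n) \<Rightarrow> ('n \<Rightarrow> real) \<Rightarrow> nat \<Rightarrow> real ^ 'n ^ 'n" where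
  "Phi1 M v lam J = fun_of_K M v lam (q_fun J (J + 1))"

end

theory Submission
  imports Defs
begin

text \<open>
  The sum of the functions \<open>p_j\<close> telescopes to 1, and in the orthonormal eigenbasis each filter
  multiplies the \<open>i\<close>-th coordinate of \<open>M x\<close> by \<open>q_j (\<lambda>\<^sub>i)\<close>, whose square is
  \<open>p_j (\<lambda>\<^sub>i)\<close> as soon as \<open>\<lambda>\<^sub>i \<in> [0, 1]\<close>. For the latter, the spectrum of the normalized
  Laplacian has to lie in \<open>[0, 2]\<close>, which follows from
  \<open>0 \<le> \<Sum>\<^sub>i\<^sub>j A\<^sub>i\<^sub>j (y\<^sub>i \<plusminus> y\<^sub>j)\<^sup>2 = 2 (\<Sum>\<^sub>i d\<^sub>i y\<^sub>i\<^sup>2 \<plusminus> y \<bullet> A y)\<close>.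
\<close>

lemma diag_matrix_mult_vec: "diag_matrix a *v x = (\<chi> i. a i * x $ i)"
  by (simp add: vec_eq_iff diag_matrix_def matrix_vector_mult_def if_distrib[where f = "\<lambda>z. z * _"]
      cong: if_cong)

lemma norm_vec_square: "(norm (x :: real ^ 'n))\<^sup>2 = (\<Sum>i\<in>UNIV. (x $ i)\<^sup>2)"
  unfolding power2_norm_eq_inner by (simp add: inner_vec_def power2_eq_square)

lemma orthogonal_matrix_norm:
  fixes Q :: "real ^ 'n ^ 'n"
  assumes "orthogonal_matrix Q"
  shows "norm (Q *v x) = norm x"
  using assms by (simp add: orthogonal_transformation_matrix orthogonal_transformation_norm)

text \<open>The entries of \<open>transpose V ** V\<close> are the inner products of the
  columns.\<close>

lemma orthogonal_columns_matrix:
  assumes "\<And>i j. v i \<bullet> v j = (if i = j then 1 else 0)"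
  shows "orthogonal_matrix (columns_matrix v)"
proof -
  have "transpose (columns_matrix v) ** columns_matrix v = mat 1"
    using assms
    by (simp add: vec_eq_iff columns_matrix_def transpose_def matrix_matrix_mult_def mat_def
        inner_vec_def)
  then show ?thesis
    by (simp add: orthogonal_matrix)
qed

text \<open>With D the diagonal matrix of row sums, this says that D + A and D - A are both positive
  semidefinite.\<close>

lemma abs_symmetric_quadratic_form_le:
  fixes A :: "real ^ 'n ^ 'n"
  assumes nonneg: "\<And>i j. 0 \<le> A $ i $ j" and sym: "\<And>i j. A $ i $ j = A $ j $ i"
  shows "\<bar>y \<bullet> (A *v y)\<bar> \<le> (\<Sum>i\<in>UNIV. (\<Sum>j\<in>UNIV. A $ i $ j) * (y $ i)\<^sup>2)"
proof -
  define S where "S = (\<Sum>i\<in>UNIV. (\<Sum>j\<in>UNIV. A $ i $ j) * (y $ i)\<^sup>2)"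
  have S1: "S = (\<Sum>i\<in>UNIV. \<Sum>j\<in>UNIV. A $ i $ j * (y $ i)\<^sup>2)"
    by (simp add: S_def sum_distrib_right)
  have S2: "S = (\<Sum>i\<in>UNIV. \<Sum>j\<in>UNIV. A $ i $ j * (y $ j)\<^sup>2)"
    unfolding S1 by (subst sum.swap) (simp add: sym)
  have Q: "y \<bullet> (A *v y) = (\<Sum>i\<in>UNIV. \<Sum>j\<in>UNIV. A $ i $ j * (y $ i * y $ j))"
    by (simp add: inner_vec_def matrix_vector_mult_def sum_distrib_left mult_ac)
  \<comment> \<open>One expansion serves both signs: \<open>s = 1\<close> yields the lower bound on
    the quadratic form, \<open>s = -1\<close> the upper one.\<close>
  have expand: "(\<Sum>i\<in>UNIV. \<Sum>j\<in>UNIV. A $ i $ j * (y $ i + s * y $ j)\<^sup>2)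
      = 2 * (S + s * (y \<bullet> (A *v y)))" if "s\<^sup>2 = 1" for s
  proof -
    have "A $ i $ j * (y $ i + s * y $ j)\<^sup>2 = A $ i $ j * (y $ i)\<^sup>2 + A $ i $ j * (y $ j)\<^sup>2
        + 2 * s * (A $ i $ j * (y $ i * y $ j))" for i j
      using that by (simp add: power2_sum power_mult_distrib algebra_simps)
    then have "(\<Sum>i\<in>UNIV. \<Sum>j\<in>UNIV. A $ i $ j * (y $ i + s * y $ j)\<^sup>2)
        = S + S + 2 * s * (y \<bullet> (A *v y))"
      by (simp only: sum.distrib flip: S1 S2 Q sum_distrib_left)
    then show ?thesis
      by simp
  qed
  have nn: "0 \<le> (\<Sum>i\<in>UNIV. \<Sum>j\<in>UNIV. A $ i $ j * (y $ i + s * y $ j)\<^sup>2)" for s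
    by (intro sum_nonneg mult_nonneg_nonneg nonneg) auto
  have "0 \<le> 2 * (S + s * (y \<bullet> (A *v y)))" if "s\<^sup>2 = 1" for s
    unfolding expand[OF that, symmetric] by (rule nn)
  from this[of 1] this[of "-1"] have "\<bar>y \<bullet> (A *v y)\<bar> \<le> S"
    by simp
  then show ?thesis
    unfolding S_def .
qed

text \<open>Pairing the eigenvalue equation with the unit vector \<open>u\<close> gives
  \<open>w = 1 - y \<bullet> (A *v y)\<close> for the rescaled vector
  \<open>y = diag_matrix r *v u\<close>, and the quadratic form is at most 1 in absolute
  value.\<close>

lemma normalized_laplacian_eigenvalue_bounds:
  fixes E :: "'n::finite set set"
  assumes graph: "weighted_graph E W"
    and eigen: "normalized_laplacian E W *v u = w *\<^sub>R u" and unit: "u \<bullet> u = 1"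
  shows "w \<in> {0..2}"
proof -
  define A where "A = adj_matrix E W"
  define r where "r i = 1 / sqrt (degree_vec E W $ i)" for i
  define y where "y = diag_matrix r *v u"
  have A: "0 \<le> A $ i $ j" "A $ i $ j = A $ j $ i" for i j
    using graph
    by (auto simp: A_def adj_matrix_def weighted_graph_def insert_commute intro: less_imp_le)
  have deg: "degree_vec E W $ i = (\<Sum>j\<in>UNIV. A $ i $ j)" for i
    by (simp add: degree_vec_def A_def)
  have deg_nonneg: "0 \<le> degree_vec E W $ i" for i
    unfolding deg by (intro sum_nonneg A)
  \<comment> \<open>Equality unless \<open>d\<^sub>i = 0\<close>, where \<open>r i = 0\<close>.\<close>
  have "degree_vec E W $ i * (y $ i)\<^sup>2 \<le> (u $ i)\<^sup>2" for i
    using deg_nonneg[of i]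
    by (cases "degree_vec E W $ i = 0")
      (simp_all add: y_def diag_matrix_mult_vec r_def power_mult_distrib power_divide)
  then have "(\<Sum>i\<in>UNIV. degree_vec E W $ i * (y $ i)\<^sup>2) \<le> (norm u)\<^sup>2"
    unfolding norm_vec_square by (intro sum_mono)
  with abs_symmetric_quadratic_form_le[of A y] A have bound: "\<bar>y \<bullet> (A *v y)\<bar> \<le> 1"
    by (simp add: deg power2_norm_eq_inner unit)
  have "normalized_laplacian E W *v u = u - diag_matrix r *v (A *v y)"
    by (simp add: normalized_laplacian_def Let_def A_def y_def r_def[abs_def]
        matrix_vector_mult_diff_rdistrib matrix_vector_mul_assoc matrix_mul_assoc)
  moreover have "u \<bullet> (diag_matrix r *v z) = y \<bullet> z" for z
    by (simp add: y_def diag_matrix_mult_vec inner_vec_def mult_ac)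
  ultimately have "u \<bullet> (w *\<^sub>R u) = 1 - y \<bullet> (A *v y)"
    unfolding eigen[symmetric] by (simp add: inner_diff_right unit)
  then show ?thesis
    using bound by (auto simp: unit)
qed

lemma p_fun_nonneg:
  assumes "0 \<le> t" "t \<le> 1"
  shows "0 \<le> p_fun J j t"
proof -
  \<comment> \<open>For \<open>j = 0\<close> the truncated \<open>j - 1\<close> makes both exponents
    equal, so the inequality is trivial there.\<close>
  have "t ^ 2 ^ j \<le> t ^ 2 ^ (j - 1)"
    using assms by (intro power_decreasing power_increasing) auto
  then show ?thesis
    using assms by (simp add: p_fun_def)
qed

lemma sum_p_fun: "(\<Sum>j=0..J. p_fun J j t) + p_fun J (J + 1) t = 1"
proof -
  \<comment> \<open>The bound \<open>k \<le> J\<close> keeps every summand with \<open>j > 0\<close>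
    in the middle branch of \<open>p_fun\<close>, so the sum telescopes; at \<open>k = J\<close> the
    missing power is exactly the low-pass term.\<close>
  have "(\<Sum>j=0..k. p_fun J j t) = 1 - t ^ 2 ^ k" if "k \<le> J" for k
    using that by (induction k) (simp_all add: p_fun_def)
  then show ?thesis
    by (simp add: p_fun_def)
qed

text \<open>The outer \<open>M\<close> cancels \<open>matrix_inv M\<close> and \<open>V\<close>
  preserves the norm, which leaves a diagonal matrix acting on the coordinates of
  \<open>M *v x\<close> in the basis \<open>v\<close>.\<close>

lemma norm_wrt_fun_of_K:
  fixes M :: "real ^ 'n ^ 'n"
  assumes "invertible M" and V: "orthogonal_matrix (columns_matrix v)"
  shows "(norm_wrt M (fun_of_K M v lam f *v x))\<^sup>2
    = (\<Sum>i\<in>UNIV. (f (lam i))\<^sup>2 * ((transpose (columns_matrix v) *v (M *v x)) $ i)\<^sup>2)"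
proof -
  let ?V = "columns_matrix v"
  \<comment> \<open>\<open>matrix_inv\<close> is defined by choice; invertibility supplies the
    witness.\<close>
  have "M ** matrix_inv M = mat 1"
    using assms(1) unfolding invertible_def matrix_inv_def by (rule someI2_ex) blast
  then have inv: "M ** (matrix_inv M ** B) = B" for B
    by (simp add: matrix_mul_assoc)
  have "M *v (fun_of_K M v lam f *v x)
      = ?V *v (diag_matrix (\<lambda>i. f (lam i)) *v (transpose ?V *v (M *v x)))"
    by (simp add: fun_of_K_def Let_def matrix_vector_mul_assoc inv flip: matrix_mul_assoc)
  then show ?thesis
    by (simp add: norm_wrt_def orthogonal_matrix_norm[OF V] norm_vec_square diag_matrix_mult_vec
        power_mult_distrib)
qed

theorem proposition2p1:
  fixes E :: "'n::{finite,linorder} set set"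
    and W :: "'n set \<Rightarrow> real"
    and \<omega> :: "'n \<Rightarrow> real"
    and v :: "'n \<Rightarrow> (real, 'n) vec"
    and g :: "real \<Rightarrow> real"
    and M :: "((real, 'n) vec, 'n) vec"
    and J :: nat
    and x :: "(real, 'n) vec"
  assumes "weighted_graph E W"
    and "connected_graph E"
    and "orthonormal_eigenbasis (normalized_laplacian E W) \<omega> v"
    and "g \<in> {0..2} \<rightarrow> {0..1}"
    and "antimono_on {0..2} g"
    and "g 0 = 1"
    and "g 2 = 0"
    and "invertible M"
  shows "(\<Sum>j=0..J. (norm_wrt M (Psi1 M v (\<lambda>i. g (\<omega> i)) J j *v x))\<^sup>2)
           + (norm_wrt M (Phi1 M v (\<lambda>i. g (\<omega> i)) J *v x))\<^sup>2
         = (norm_wrt M x)\<^sup>2"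
proof -
  define lam where "lam i = g (\<omega> i)" for i
  define c where "c = transpose (columns_matrix v) *v (M *v x)"
  have ortho: "v i \<bullet> v j = (if i = j then 1 else 0)"
    and eigen: "normalized_laplacian E W *v v i = \<omega> i *\<^sub>R v i" for i j
    using assms(3) by (auto simp: orthonormal_eigenbasis_def)
  have V: "orthogonal_matrix (columns_matrix v)"
    by (rule orthogonal_columns_matrix) (rule ortho)
  have "\<omega> i \<in> {0..2}" for i
    using normalized_laplacian_eigenvalue_bounds[OF assms(1) eigen] by (simp add: ortho)
  then have "lam i \<in> {0..1}" for i
    unfolding lam_def using assms(4) by blast
  \<comment> \<open>Squaring undoes the root because \<open>p_fun\<close> is nonnegative on the unit
    interval.\<close>
  then have q: "(q_fun J j (lam i))\<^sup>2 = p_fun J j (lam i)" for i j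
    by (simp add: q_fun_def p_fun_nonneg)
  have filt: "(norm_wrt M (fun_of_K M v lam (q_fun J j) *v x))\<^sup>2
      = (\<Sum>i\<in>UNIV. p_fun J j (lam i) * (c $ i)\<^sup>2)" for j
    by (simp add: norm_wrt_fun_of_K[OF assms(8) V] q c_def)
  \<comment> \<open>Exchanging the sums collects the weights of all filters on each coordinate; they
    total 1.\<close>
  have "(\<Sum>j=0..J. \<Sum>i\<in>UNIV. p_fun J j (lam i) * (c $ i)\<^sup>2)
        + (\<Sum>i\<in>UNIV. p_fun J (J + 1) (lam i) * (c $ i)\<^sup>2)
      = (\<Sum>i\<in>UNIV. ((\<Sum>j=0..J. p_fun J j (lam i)) + p_fun J (J + 1) (lam i)) * (c $ i)\<^sup>2)"
    by (subst sum.swap) (simp only: sum.distrib distrib_right sum_distrib_right)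
  also have "\<dots> = (norm c)\<^sup>2"
    by (simp only: sum_p_fun norm_vec_square mult_1)
  \<comment> \<open>This is Parseval's identity: the transpose of an orthogonal matrix is
    orthogonal.\<close>
  also have "\<dots> = (norm_wrt M x)\<^sup>2"
    using V unfolding c_def norm_wrt_def
    by (subst orthogonal_matrix_norm) (simp_all add: orthogonal_matrix_transpose)
  finally show ?thesis
    unfolding Psi1_def Phi1_def lam_def[symmetric, abs_def] filt .
qed

end
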